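(* Let $\mathcal{Q},\mathcal{U},\mathcal{V},\mathcal{Y},\mathcal{Z}$ be nonzero finite dimensional real Hilbert spaces with $\dim\mathcal{U}=\dim\mathcal{V}$, let $R:\mathcal{Q}\to\mathcal{Z}$ and $A:\mathcal{U}\to\mathcal{V}$ be invertible linear maps, let $T:\mathcal{Q}\to\mathcal{V}$ and $B:\mathcal{U}\to\mathcal{Y}$ be linear maps, and let $\alpha>0$, $\rho>0$. Let $K$, $P$, $E:=P^{-1/2}KP^{-1/2}$, $Q_R$ and $Q_J$ be the operators defined in the context. Assume that $\delta$ and $\beta$ are real constants such that $$0<\delta\le\tfrac12\lambda_{\min}(Q_R+Q_J)\qquad\text{and}\qquad \lambda_{\max}(Q_RQ_J)^{1/2}\le\beta<1 .$$ Then $$\operatorname{cond}(E)\le\frac{3}{(1-\beta)\,\delta}.$$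
   Context: Stars denote Hilbert space adjoints; empty blocks are zero operators; $I$ is the identity. The operators $K$ (KKT operator) and $P$ (preconditioner) act on $\mathcal{Q}\oplus\mathcal{U}\oplus\mathcal{V}$ and are $$K=\begin{bmatrix}\alpha R^*R & & T^*\\ & B^*B & A^*\\ T & A & \end{bmatrix},\qquad P=\begin{bmatrix}\alpha R^*R+\rho T^*T & & \\ & B^*B+\rho A^*A & \\ & & \frac1\rho I\end{bmatrix}.$$ $P$ is self-adjoint positive definite, and $P^{-1/2}$ is the inverse of its positive definite square root. The operators $Q_R,Q_J:\mathcal{V}\to\mathcal{V}$ ("damped projectors") are $$Q_R:=T\left(\tfrac{\alpha}{\rho}R^*R+T^*T\right)^{-1}T^*,\qquad Q_J:=A\left(\tfrac1\rho B^*B+A^*A\right)^{-1}A^*.$$ Both are self-adjoint positive semidefinite, so $Q_R+Q_J$ has real eigenvalues and $Q_RQ_J$ has real nonnegative eigenvalues; $\lambda_{\min}$, $\lambda_{\max}$ denote the smallest and largest eigenvalues. $\operatorname{cond}(E)=\sigma_{\max}(E)/\sigma_{\min}(E)$ is the ratio of the largest to the smallest singular value. *)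

theory Defs
  imports "HOL-Analysis.Analysis" "HOL-Library.Extended_Real"
begin

text \<open>
  Nonzero finite dimensional real Hilbert spaces are types of class \<^class>\<open>euclidean_space\<close>;
  the inner product of the product type \<open>'q \<times> 'u \<times> 'v\<close> is that of the orthogonal direct sum.
  The Hilbert space adjoint is the library's \<^const>\<open>adjoint\<close>.
\<close>

definition self_adjoint :: "('a::euclidean_space \<Rightarrow> 'a) \<Rightarrow> bool" where
  "self_adjoint f \<longleftrightarrow> linear f \<and> adjoint f = f"

definition positive_definite :: "('a::euclidean_space \<Rightarrow> 'a) \<Rightarrow> bool" where
  "positive_definite f \<longleftrightarrow> self_adjoint f \<and> (\<forall>x. x \<noteq> 0 \<longrightarrow> 0 < f x \<bullet> x)"

definition pd_sqrt :: "('a::euclidean_space \<Rightarrow> 'a) \<Rightarrow> 'a \<Rightarrow> 'a" where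
  "pd_sqrt f = (THE s. positive_definite s \<and> s \<circ> s = f)"

definition eigenvalues :: "('a::euclidean_space \<Rightarrow> 'a) \<Rightarrow> real set" where
  "eigenvalues f = {l. \<exists>x. x \<noteq> 0 \<and> f x = l *\<^sub>R x}"

text \<open>
  Only real eigenvalues are collected, so the next two notions are meant for operators whose
  (complex) spectrum is real and nonempty.
\<close>

definition lambda_min :: "('a::euclidean_space \<Rightarrow> 'a) \<Rightarrow> real" where
  "lambda_min f = Min (eigenvalues f)"

definition lambda_max :: "('a::euclidean_space \<Rightarrow> 'a) \<Rightarrow> real" where
  "lambda_max f = Max (eigenvalues f)"

definition singular_values :: "('a::euclidean_space \<Rightarrow> 'a) \<Rightarrow> real set" where
  "singular_values f = sqrt ` eigenvalues (adjoint f \<circ> f)"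

definition sigma_min :: "('a::euclidean_space \<Rightarrow> 'a) \<Rightarrow> real" where
  "sigma_min f = Min (singular_values f)"

definition sigma_max :: "('a::euclidean_space \<Rightarrow> 'a) \<Rightarrow> real" where
  "sigma_max f = Max (singular_values f)"

text \<open>
  The condition number of a singular operator is \<open>\<infinity>\<close>; with values in \<^typ>\<open>real\<close>, the convention
  \<open>x / 0 = 0\<close> would make any upper bound on it hold trivially.
\<close>

definition cond :: "('a::euclidean_space \<Rightarrow> 'a) \<Rightarrow> ereal" where
  "cond f = (if sigma_min f = 0 then \<infinity> else ereal (sigma_max f / sigma_min f))"

definition kkt_op ::
  "real \<Rightarrow> ('q::euclidean_space \<Rightarrow> 'z::euclidean_space) \<Rightarrow> ('q \<Rightarrow> 'v::euclidean_space) \<Rightarrow>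
   ('u::euclidean_space \<Rightarrow> 'y::euclidean_space) \<Rightarrow> ('u \<Rightarrow> 'v) \<Rightarrow> 'q \<times> 'u \<times> 'v \<Rightarrow> 'q \<times> 'u \<times> 'v" where
  "kkt_op \<alpha> R T B A = (\<lambda>(q, u, v).
     (\<alpha> *\<^sub>R adjoint R (R q) + adjoint T v,
      adjoint B (B u) + adjoint A v,
      T q + A u))"

definition precond_op ::
  "real \<Rightarrow> real \<Rightarrow> ('q::euclidean_space \<Rightarrow> 'z::euclidean_space) \<Rightarrow> ('q \<Rightarrow> 'v::euclidean_space) \<Rightarrow>
   ('u::euclidean_space \<Rightarrow> 'y::euclidean_space) \<Rightarrow> ('u \<Rightarrow> 'v) \<Rightarrow> 'q \<times> 'u \<times> 'v \<Rightarrow> 'q \<times> 'u \<times> 'v" where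
  "precond_op \<alpha> \<rho> R T B A = (\<lambda>(q, u, v).
     (\<alpha> *\<^sub>R adjoint R (R q) + \<rho> *\<^sub>R adjoint T (T q),
      adjoint B (B u) + \<rho> *\<^sub>R adjoint A (A u),
      (1 / \<rho>) *\<^sub>R v))"

definition precond_kkt_op ::
  "real \<Rightarrow> real \<Rightarrow> ('q::euclidean_space \<Rightarrow> 'z::euclidean_space) \<Rightarrow> ('q \<Rightarrow> 'v::euclidean_space) \<Rightarrow>
   ('u::euclidean_space \<Rightarrow> 'y::euclidean_space) \<Rightarrow> ('u \<Rightarrow> 'v) \<Rightarrow> 'q \<times> 'u \<times> 'v \<Rightarrow> 'q \<times> 'u \<times> 'v" where
  "precond_kkt_op \<alpha> \<rho> R T B A =
     inv (pd_sqrt (precond_op \<alpha> \<rho> R T B A)) \<circ> kkt_op \<alpha> R T B A \<circ>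
     inv (pd_sqrt (precond_op \<alpha> \<rho> R T B A))"

definition damped_proj_R ::
  "real \<Rightarrow> real \<Rightarrow> ('q::euclidean_space \<Rightarrow> 'z::euclidean_space) \<Rightarrow> ('q \<Rightarrow> 'v::euclidean_space) \<Rightarrow>
   'v \<Rightarrow> 'v" where
  "damped_proj_R \<alpha> \<rho> R T =
     T \<circ> inv (\<lambda>q. (\<alpha> / \<rho>) *\<^sub>R adjoint R (R q) + adjoint T (T q)) \<circ> adjoint T"

definition damped_proj_J ::
  "real \<Rightarrow> ('u::euclidean_space \<Rightarrow> 'y::euclidean_space) \<Rightarrow> ('u \<Rightarrow> 'v::euclidean_space) \<Rightarrow>
   'v \<Rightarrow> 'v" where
  "damped_proj_J \<rho> B A =
     A \<circ> inv (\<lambda>u. (1 / \<rho>) *\<^sub>R adjoint B (B u) + adjoint A (A u)) \<circ> adjoint A"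

end

theory Submission
  imports Defs
begin

text \<open>
  Let \<open>s\<close>, \<open>t\<close> be the square roots of the first two diagonal blocks of \<open>P\<close> and put
  \<open>X = \<rho>\<^sup>\<onehalf> T s\<^sup>-\<^sup>1\<close>, \<open>Y = \<rho>\<^sup>\<onehalf> A t\<^sup>-\<^sup>1\<close>. Then \<open>X X\<^sup>* = Q\<^sub>R\<close>, \<open>Y Y\<^sup>* = Q\<^sub>J\<close>, both \<open>X\<close> and \<open>Y\<close> are
  contractions, and \<open>E\<close> has the rows \<open>(I - X\<^sup>*X, 0, X\<^sup>*)\<close>, \<open>(0, I - Y\<^sup>*Y, Y\<^sup>*)\<close>, \<open>(X, Y, 0)\<close>. The
  hypotheses on the spectra become \<open>\<bar>Xq \<bullet> Yu\<bar> \<le> \<beta> \<bar>q\<bar> \<bar>u\<bar>\<close> and \<open>\<bar>X\<^sup>*v\<bar>\<^sup>2 + \<bar>Y\<^sup>*v\<bar>\<^sup>2 \<ge> 2 \<delta> \<bar>v\<bar>\<^sup>2\<close>.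
  Contractivity gives \<open>\<bar>E\<bar> \<le> 2\<^sup>\<onehalf>\<close>. Since \<open>E\<close> is self-adjoint, its smallest singular value is the
  least modulus of an eigenvalue; positive eigenvalues are at least \<open>1 - \<beta>\<close>, the others have
  modulus at least \<open>(1 - \<beta>) \<delta> / 2\<close>. Finally \<open>2 \<cdot> 2\<^sup>\<onehalf> \<le> 3\<close>.
\<close>

subsection \<open>Spectral theory of self-adjoint operators\<close>

lemma self_adjointI:
  assumes "linear f" and "\<And>x y. f x \<bullet> y = x \<bullet> f y"
  shows "self_adjoint f"
  unfolding self_adjoint_def using assms adjoint_unique[of f f] by metis

lemma self_adjoint_linear: "self_adjoint f \<Longrightarrow> linear f"
  by (simp add: self_adjoint_def)

lemma self_adjointD: "self_adjoint f \<Longrightarrow> f x \<bullet> y = x \<bullet> f y"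
  using adjoint_works[of f x y] by (simp add: self_adjoint_def)

lemma inner_adjoint_left:
  fixes f :: "'a::euclidean_space \<Rightarrow> 'b::euclidean_space"
  assumes "linear f"
  shows "adjoint f y \<bullet> x = y \<bullet> f x"
  using adjoint_works[OF assms, of x y] by (simp add: inner_commute)

text \<open>Compactness of the unit sphere of \<open>S\<close> yields a minimizer \<open>x\<close>
  of the Rayleigh quotient. The residual \<open>h = f x - l x\<close> stays in \<open>S\<close> by
  invariance, so it is an admissible direction of variation, and minimality forces it to
  vanish.\<close>

lemma rayleigh_minimum:
  fixes f :: "'a::euclidean_space \<Rightarrow> 'a"
  assumes f: "self_adjoint f" and S: "subspace S" and inv: "f ` S \<subseteq> S" and ne: "S \<noteq> {0}"
  obtains x l where "x \<in> S" "norm x = 1" "f x = l *\<^sub>R x"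
    "\<And>y. y \<in> S \<Longrightarrow> l * (y \<bullet> y) \<le> f y \<bullet> y"
proof -
  have lin: "linear f" using f by (rule self_adjoint_linear)
  have "0 \<in> S" using S by (rule subspace_0)
  then have "S = {0}" if "\<not> (\<exists>z\<in>S. z \<noteq> 0)" using that by auto
  with ne obtain z where z: "z \<in> S" "z \<noteq> 0" by metis
  let ?K = "S \<inter> sphere 0 1"
  have "(1 / norm z) *\<^sub>R z \<in> ?K" using z S by (simp add: subspace_scale)
  then have Kne: "?K \<noteq> {}" by blast
  have "compact ?K" using S by (intro closed_Int_compact closed_subspace) auto
  moreover have "continuous_on ?K (\<lambda>y. f y \<bullet> y)"
    by (intro continuous_intros linear_continuous_on linear_conv_bounded_linear[THEN iffD1] lin)
  ultimately obtain x where x: "x \<in> ?K" and min: "\<And>y. y \<in> ?K \<Longrightarrow> f x \<bullet> x \<le> f y \<bullet> y"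
    using continuous_attains_inf[of ?K "\<lambda>y. f y \<bullet> y"] Kne by blast
  define l where "l = f x \<bullet> x"
  have xS: "x \<in> S" and xn: "norm x = 1" using x by auto
  have bound: "l * (y \<bullet> y) \<le> f y \<bullet> y" if y: "y \<in> S" for y
  proof (cases "y = 0")
    case False
    have "(1 / norm y) *\<^sub>R y \<in> ?K" using y False S by (simp add: subspace_scale)
    from min[OF this] have "l \<le> (f y \<bullet> y) / (norm y)\<^sup>2"
      by (simp add: l_def linear_scale[OF lin] power2_eq_square)
    then show ?thesis using False by (simp add: field_simps power2_norm_eq_inner)
  qed (simp add: linear_0[OF lin])
  define h where "h = f x - l *\<^sub>R x"
  define c where "c = f h \<bullet> h - l * (h \<bullet> h)"
  have hS: "h \<in> S" unfolding h_def using xS inv S by (auto intro: subspace_diff subspace_scale)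
  have xx: "x \<bullet> x = 1" using xn by (simp add: power2_norm_eq_inner[symmetric])
  \<comment> \<open>The quadratic form of \<open>f - l\<close> is nonnegative on \<open>S\<close>
    and zero at \<open>x\<close>; here it is expanded along the line \<open>x + t h\<close>.\<close>
  have quad: "0 \<le> 2 * t * (h \<bullet> h) + t\<^sup>2 * c" for t
  proof -
    have "x + t *\<^sub>R h \<in> S" using xS hS S by (simp add: subspace_add subspace_scale)
    from bound[OF this] have "0 \<le> f (x + t *\<^sub>R h) \<bullet> (x + t *\<^sub>R h) - l * ((x + t *\<^sub>R h) \<bullet> (x + t *\<^sub>R h))"
      by simp
    also have "\<dots> = (f x \<bullet> x - l * (x \<bullet> x)) + 2 * t * (f x \<bullet> h - l * (x \<bullet> h)) + t\<^sup>2 * c"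
      using self_adjointD[OF f, of x h]
      by (simp add: c_def linear_add[OF lin] linear_scale[OF lin] inner_add_left inner_add_right
          inner_commute power2_eq_square algebra_simps)
    also have "f x \<bullet> h - l * (x \<bullet> h) = h \<bullet> h"
      by (simp add: h_def inner_diff_left)
    finally show ?thesis by (simp add: l_def xx)
  qed
  have "h \<bullet> h = 0"
  proof (rule ccontr)
    assume "h \<bullet> h \<noteq> 0"
    then have hp: "h \<bullet> h > 0" by simp
    \<comment> \<open>A negative \<open>t\<close> this small lets the linear term dominate, so
      \<open>quad\<close> fails; the summand 1 covers \<open>c = 0\<close>.\<close>
    define t where "t = - (h \<bullet> h) / (\<bar>c\<bar> + 1)"
    have t: "t < 0" unfolding t_def using hp by (simp add: field_simps)
    have "\<bar>t\<bar> * \<bar>c\<bar> \<le> h \<bullet> h" unfolding t_def using hp by (simp add: field_simps)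
    then have "t * c \<ge> - (h \<bullet> h)" by (metis abs_le_D2 abs_mult minus_le_iff)
    then have "2 * (h \<bullet> h) + t * c > 0" using hp by linarith
    then have "t * (2 * (h \<bullet> h) + t * c) < 0" using t by (simp add: mult_neg_pos)
    with quad[of t] show False by (simp add: power2_eq_square algebra_simps)
  qed
  then have "f x = l *\<^sub>R x" by (simp add: h_def)
  from that[OF xS xn this bound] show ?thesis .
qed

text \<open>Induction on the dimension: split off one eigenvector. Its orthogonal complement in
  \<open>S\<close> is again invariant because \<open>f\<close> is self-adjoint, which is why
  invariant subspaces appear in place of the whole space.\<close>

lemma spectral_basis_subspace:
  fixes f :: "'a::euclidean_space \<Rightarrow> 'a"
  assumes f: "self_adjoint f" and "subspace S" and "f ` S \<subseteq> S"
  shows "\<exists>B l. finite B \<and> pairwise orthogonal B \<and> (\<forall>b\<in>B. norm b = 1 \<and> f b = l b *\<^sub>R b) \<and> span B = S"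
  using assms(2,3)
proof (induction "dim S" arbitrary: S rule: less_induct)
  case less
  note S = less.prems(1) and inv = less.prems(2)
  have lin: "linear f" using f by (rule self_adjoint_linear)
  show ?case
  proof (cases "S = {0}")
    case True
    then show ?thesis by (intro exI[of _ "{}"]) auto
  next
    case False
    obtain x k where x: "x \<in> S" "norm x = 1" "f x = k *\<^sub>R x"
      using rayleigh_minimum[OF f S inv False] by metis
    have xx: "x \<bullet> x = 1" using x(2) by (simp add: power2_norm_eq_inner[symmetric])
    let ?S' = "{y \<in> S. x \<bullet> y = 0}"
    have S': "subspace ?S'" using S by (auto simp: subspace_def inner_add_right)
    have inv': "f ` ?S' \<subseteq> ?S'"
      using inv self_adjointD[OF f, of x, symmetric] x(3) by (auto simp: image_subset_iff)
    have "x \<notin> ?S'" using xx by simp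
    then have "?S' \<subset> S" using x(1) by blast
    then have "dim ?S' < dim S"
      using S S' by (metis dim_psubset span_eq_iff)
    from less.hyps[OF this S' inv'] obtain B l where
      B: "finite B" "pairwise orthogonal B" "\<And>b. b \<in> B \<Longrightarrow> norm b = 1 \<and> f b = l b *\<^sub>R b" "span B = ?S'"
      by blast
    have BS: "B \<subseteq> ?S'" using B(4) span_superset by blast
    then have xB: "x \<notin> B" using xx by auto
    have "span (insert x B) = S"
    proof
      show "span (insert x B) \<subseteq> S" using x(1) BS S by (intro span_minimal) auto
      show "S \<subseteq> span (insert x B)"
      proof
        fix y assume y: "y \<in> S"
        have "y - (x \<bullet> y) *\<^sub>R x \<in> ?S'"
          using x(1) y S xx by (simp add: subspace_diff subspace_scale inner_diff_right)
        then show "y \<in> span (insert x B)" using B(4) span_breakdown_eq by blast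
      qed
    qed
    moreover have "pairwise orthogonal (insert x B)"
      using B(2) BS by (auto simp: pairwise_insert orthogonal_def inner_commute)
    ultimately show ?thesis
      using B(1,3) x(2,3) xB
      by (intro exI[of _ "insert x B"] exI[of _ "l(x := k)"]) auto
  qed
qed

lemma spectral_basis:
  fixes f :: "'a::euclidean_space \<Rightarrow> 'a"
  assumes f: "self_adjoint f"
  obtains B l where "finite B" "pairwise orthogonal B" "span B = UNIV"
    "\<And>b. b \<in> B \<Longrightarrow> norm b = 1" "\<And>b. b \<in> B \<Longrightarrow> f b = l b *\<^sub>R b"
  using spectral_basis_subspace[OF f subspace_UNIV] by auto

text \<open>An eigenvector is not orthogonal to every member \<open>b\<close> of an eigenbasis, and
  pairing it with such a \<open>b\<close> forces its eigenvalue to be \<open>l b\<close>. Finiteness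
  gives \<open>Min\<close> and \<open>Max\<close> their meaning.\<close>

lemma finite_eigenvalues:
  fixes f :: "'a::euclidean_space \<Rightarrow> 'a"
  assumes f: "self_adjoint f"
  shows "finite (eigenvalues f)"
proof -
  obtain B l where B: "finite B" "span B = UNIV" "\<And>b. b \<in> B \<Longrightarrow> f b = l b *\<^sub>R b"
    using spectral_basis[OF f] by metis
  have "eigenvalues f \<subseteq> l ` B"
  proof
    fix m assume "m \<in> eigenvalues f"
    then obtain x where x: "x \<noteq> 0" "f x = m *\<^sub>R x" by (auto simp: eigenvalues_def)
    have "\<exists>b\<in>B. x \<bullet> b \<noteq> 0"
    proof (rule ccontr)
      assume "\<not> ?thesis"
      then have "orthogonal x x"
        using B(2) by (intro orthogonal_to_span[of x B]) (auto simp: orthogonal_def)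
      then show False using x by (simp add: orthogonal_def)
    qed
    then obtain b where b: "b \<in> B" "x \<bullet> b \<noteq> 0" by blast
    have "m * (x \<bullet> b) = l b * (x \<bullet> b)"
      using self_adjointD[OF f, of x b] x b B(3) by simp
    then show "m \<in> l ` B" using b by simp
  qed
  then show ?thesis using B(1) finite_surj by blast
qed

lemma min_eigenvalue:
  fixes f :: "'a::euclidean_space \<Rightarrow> 'a"
  assumes f: "self_adjoint f"
  obtains l where "l \<in> eigenvalues f" "\<And>y. l * (y \<bullet> y) \<le> f y \<bullet> y"
proof -
  have "(UNIV :: 'a set) \<noteq> {0}" using nonempty_Basis nonzero_Basis by blast
  then obtain x l where "norm x = 1" "f x = l *\<^sub>R x" "\<And>y. l * (y \<bullet> y) \<le> f y \<bullet> y"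
    using rayleigh_minimum[OF f subspace_UNIV] by (metis UNIV_I subset_UNIV)
  moreover from this have "x \<noteq> 0" by auto
  ultimately show ?thesis using that unfolding eigenvalues_def by blast
qed

lemma max_eigenvalue:
  fixes f :: "'a::euclidean_space \<Rightarrow> 'a"
  assumes f: "self_adjoint f"
  obtains l where "l \<in> eigenvalues f" "\<And>y. f y \<bullet> y \<le> l * (y \<bullet> y)"
proof -
  have "self_adjoint (\<lambda>x. - f x)"
    using self_adjointD[OF f] self_adjoint_linear[OF f]
    by (intro self_adjointI) (auto intro: linear_compose_neg)
  then obtain l where "l \<in> eigenvalues (\<lambda>x. - f x)" "\<And>y. l * (y \<bullet> y) \<le> - f y \<bullet> y"
    using min_eigenvalue by metis
  moreover from this have "- l \<in> eigenvalues f"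
    by (auto simp: eigenvalues_def) (metis minus_minus scaleR_minus_left)
  moreover have "f y \<bullet> y \<le> - l * (y \<bullet> y)" if "l * (y \<bullet> y) \<le> - f y \<bullet> y" for y
    using that by simp
  ultimately show ?thesis using that[of "- l"] by blast
qed

text \<open>\<open>g\<close> carries an eigenvector of \<open>f \<circ> g\<close> to one of
  \<open>g \<circ> f\<close> unless it kills it, which happens only for eigenvalue 0. This relates
  the product of the two damped projectors to a self-adjoint operator.\<close>

lemma eigenvalues_comp_subset:
  assumes "linear f" and "linear g"
  shows "eigenvalues (f \<circ> g) \<subseteq> insert 0 (eigenvalues (g \<circ> f))"
proof
  fix m assume "m \<in> eigenvalues (f \<circ> g)"
  then obtain x where x: "x \<noteq> 0" "f (g x) = m *\<^sub>R x" by (auto simp: eigenvalues_def)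
  have "g x \<noteq> 0" if "m \<noteq> 0" using x that linear_0[OF assms(1)] by auto
  moreover have "(g \<circ> f) (g x) = m *\<^sub>R g x" by (simp add: x linear_scale[OF assms(2)])
  ultimately show "m \<in> insert 0 (eigenvalues (g \<circ> f))"
    unfolding eigenvalues_def by blast
qed

section \<open>Square roots of positive definite operators\<close>

text \<open>The root is diagonal in an orthonormal eigenbasis of \<open>f\<close>, with the square
  roots of the eigenvalues as entries.\<close>

lemma positive_definite_sqrt_exists:
  fixes f :: "'a::euclidean_space \<Rightarrow> 'a"
  assumes f: "positive_definite f"
  obtains s where "positive_definite s" "s \<circ> s = f"
proof -
  have sf: "self_adjoint f" using f by (simp add: positive_definite_def)
  have lf: "linear f" using sf by (rule self_adjoint_linear)
  obtain B l where B: "finite B" "pairwise orthogonal B" "span B = UNIV"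
    "\<And>b. b \<in> B \<Longrightarrow> norm b = 1" "\<And>b. b \<in> B \<Longrightarrow> f b = l b *\<^sub>R b"
    using spectral_basis[OF sf] by metis
  have lpos: "l b > 0" if "b \<in> B" for b
  proof -
    have "b \<noteq> 0" and "b \<bullet> b = 1" using B(4)[OF that] by (auto simp: power2_norm_eq_inner[symmetric])
    then show ?thesis using f B(5)[OF that] by (auto simp: positive_definite_def)
  qed
  define s where "s x = (\<Sum>b\<in>B. (sqrt (l b) * (x \<bullet> b)) *\<^sub>R b)" for x
  have lin: "linear s"
    unfolding s_def
    by (intro linearI) (simp_all add: inner_add_left algebra_simps sum.distrib scaleR_sum_right)
  have sym: "s x \<bullet> y = (\<Sum>b\<in>B. sqrt (l b) * (x \<bullet> b) * (y \<bullet> b))" for x y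
    unfolding s_def by (simp add: inner_sum_left inner_commute[of y])
  have sa: "self_adjoint s"
  proof (intro self_adjointI lin)
    show "s x \<bullet> y = x \<bullet> s y" for x y
      using sym[of x y] sym[of y x] by (simp add: inner_commute mult_ac)
  qed
  have pd: "positive_definite s"
    unfolding positive_definite_def
  proof (intro conjI sa allI impI)
    fix x :: 'a assume x: "x \<noteq> 0"
    have "\<exists>b\<in>B. x \<bullet> b \<noteq> 0"
    proof (rule ccontr)
      assume "\<not> ?thesis"
      then have "orthogonal x x"
        using B(3) by (intro orthogonal_to_span[of x B]) (auto simp: orthogonal_def)
      then show False using x by (simp add: orthogonal_def)
    qed
    then obtain b where b: "b \<in> B" "x \<bullet> b \<noteq> 0" by blast
    have "0 < (\<Sum>b\<in>B. sqrt (l b) * ((x \<bullet> b) * (x \<bullet> b)))"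
      using b lpos B(1) by (intro sum_pos2[of B b])
        (auto simp: less_imp_le zero_less_mult_iff linorder_neq_iff)
    then show "0 < s x \<bullet> x" by (simp add: sym mult.assoc)
  qed
  have sB: "s b = sqrt (l b) *\<^sub>R b" if b: "b \<in> B" for b
  proof -
    have "s b = (\<Sum>c\<in>B. if c = b then sqrt (l b) *\<^sub>R b else 0)"
      unfolding s_def
    proof (rule sum.cong[OF refl])
      fix c assume "c \<in> B"
      then show "(sqrt (l c) * (b \<bullet> c)) *\<^sub>R c = (if c = b then sqrt (l b) *\<^sub>R b else 0)"
        using B(2) B(4)[OF b] b
        by (auto simp: pairwise_def orthogonal_def inner_commute power2_norm_eq_inner[symmetric])
    qed
    then show ?thesis using b B(1) by simp
  qed
  have "s \<circ> s = f"
  proof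
    fix x
    have "x \<in> span B" using B(3) by simp
    then show "(s \<circ> s) x = f x"
    proof (rule linear_eq_on[OF linear_compose[OF lin lin] lf])
      show "(s \<circ> s) b = f b" if "b \<in> B" for b
        using sB[OF that] B(5)[OF that] lpos[OF that] by (simp add: linear_scale[OF lin])
    qed
  qed
  then show ?thesis using that pd by blast
qed

lemma positive_definite_sqrt_unique:
  fixes s t :: "'a::euclidean_space \<Rightarrow> 'a"
  assumes s: "positive_definite s" and t: "positive_definite t" and eq: "s \<circ> s = t \<circ> t"
  shows "s = t"
proof -
  have ls: "linear s" and lt: "linear t" and st: "self_adjoint t"
    using s t by (auto simp: positive_definite_def self_adjoint_linear)
  obtain B l where B: "span B = UNIV"
    "\<And>b. b \<in> B \<Longrightarrow> norm b = 1" "\<And>b. b \<in> B \<Longrightarrow> t b = l b *\<^sub>R b"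
    using spectral_basis[OF st] by metis
  show ?thesis
  proof
    fix x
    have "x \<in> span B" using B(1) by simp
    then show "s x = t x"
    proof (rule linear_eq_on[OF ls lt])
      fix b assume b: "b \<in> B"
      have b0: "b \<noteq> 0" using B(2)[OF b] by auto
      have lpos: "l b > 0" 
        using t b0 B(3)[OF b] B(2)[OF b] by (auto simp: positive_definite_def power2_norm_eq_inner[symmetric])
      \<comment> \<open>From \<open>s (s b) = (l b)\<^sup>2 b\<close> follows
        \<open>s y = - l b y\<close>. A positive definite \<open>s\<close> has no negative
        eigenvalue, so \<open>y = 0\<close>, and the two roots agree on an eigenbasis of
        \<open>t\<close>.\<close>
      define y where "y = s b - l b *\<^sub>R b"
      have "s (s b) = l b *\<^sub>R (l b *\<^sub>R b)"
        using fun_cong[OF eq, of b] B(3)[OF b] by (simp add: linear_scale[OF lt])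
      then have "s y = - l b *\<^sub>R y"
        by (simp add: y_def linear_diff[OF ls] linear_scale[OF ls] algebra_simps)
      then have "s y \<bullet> y \<le> 0" using lpos by (simp add: mult_nonneg_nonneg)
      then have "y = 0" using s by (force simp: positive_definite_def)
      then show "s b = t b" using B(3)[OF b] by (simp add: y_def)
    qed
  qed
qed

lemma pd_sqrt_eqI:
  assumes "positive_definite s" and "s \<circ> s = f"
  shows "pd_sqrt f = s"
  unfolding pd_sqrt_def
  using assms by (intro the_equality) (auto intro: positive_definite_sqrt_unique)

lemma positive_definite_bij:
  fixes s :: "'a::euclidean_space \<Rightarrow> 'a"
  assumes s: "positive_definite s"
  shows "bij s"
proof -
  have ls: "linear s" using s by (auto simp: positive_definite_def self_adjoint_linear)
  have "inj s" unfolding linear_injective_0[OF ls]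
    using s by (force simp: positive_definite_def)
  then show ?thesis using linear_injective_imp_surjective[OF ls] by (simp add: bij_def)
qed

lemma self_adjoint_inv:
  fixes s :: "'a::euclidean_space \<Rightarrow> 'a"
  assumes s: "self_adjoint s" and b: "bij s"
  shows "self_adjoint (inv s)"
proof (rule self_adjointI)
  have si: "s (inv s x) = x" for x using b by (simp add: bij_is_surj surj_f_inv_f)
  have ls: "linear s" using s by (rule self_adjoint_linear)
  show "linear (inv s)"
    using inj_linear_imp_inv_linear[OF ls bij_is_inj[OF b]] .
  show "inv s x \<bullet> y = x \<bullet> inv s y" for x y
    using self_adjointD[OF s, of "inv s x" "inv s y"] by (simp add: si)
qed

section \<open>Condition numbers and operator norms\<close>

text \<open>A singular value \<sigma> equals \<open>norm (f x) / norm x\<close> for some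
  \<open>x\<close>, hence is at most \<open>M\<close>. It is also the modulus of an eigenvalue of
  \<open>f\<close>, hence at least \<open>m\<close>.\<close>

lemma cond_self_adjoint_le:
  fixes f :: "'a::euclidean_space \<Rightarrow> 'a"
  assumes f: "self_adjoint f" and M: "\<And>x. norm (f x) \<le> M * norm x"
    and m: "0 < m" and ev: "\<And>l. l \<in> eigenvalues f \<Longrightarrow> m \<le> \<bar>l\<bar>"
  shows "cond f \<le> ereal (M / m)"
proof -
  have lin: "linear f" using f by (rule self_adjoint_linear)
  have adj: "adjoint f \<circ> f = f \<circ> f" using f by (simp add: self_adjoint_def)
  have sa: "self_adjoint (f \<circ> f)"
    using linear_compose[OF lin lin] by (rule self_adjointI) (simp add: self_adjointD[OF f])
  let ?S = "singular_values f"
  have fin: "finite ?S" using finite_eigenvalues[OF sa] by (simp add: singular_values_def adj)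
  have ne: "?S \<noteq> {}" using min_eigenvalue[OF sa] by (auto simp: singular_values_def adj)
  have bounds: "m \<le> \<sigma> \<and> \<sigma> \<le> M" if "\<sigma> \<in> ?S" for \<sigma>
  proof -
    obtain x k where x: "x \<noteq> 0" "f (f x) = k *\<^sub>R x" and \<sigma>: "\<sigma> = sqrt k"
      using \<open>\<sigma> \<in> ?S\<close> by (auto simp: singular_values_def adj eigenvalues_def)
    have "norm (f x)^2 = k * norm x^2"
      using self_adjointD[OF f, of "f x" x] x(2) by (simp add: power2_norm_eq_inner)
    then have k: "k = (norm (f x) / norm x)^2"
      using x(1) by (simp add: power_divide)
    then have \<sigma>': "\<sigma> = norm (f x) / norm x" by (simp add: \<sigma>)
    then have "\<sigma> \<le> M" using M[of x] x(1) by (simp add: pos_divide_le_eq)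
    moreover have "m \<le> \<sigma>"
    proof -
      have \<sigma>0: "\<sigma> \<ge> 0" and k\<sigma>: "k = \<sigma> * \<sigma>" using k by (auto simp: \<sigma>' power2_eq_square)
      \<comment> \<open>This is the factorization of \<open>f\<^sup>2 - \<sigma>\<^sup>2\<close>:
        either \<open>y\<close> is an eigenvector for \<sigma>, or \<open>y = 0\<close> and
        \<open>x\<close> is one for \<open>- \<sigma>\<close>.\<close>
      define y where "y = f x + \<sigma> *\<^sub>R x"
      have "f y = \<sigma> *\<^sub>R y"
        by (simp add: y_def linear_add[OF lin] linear_scale[OF lin] x(2) k\<sigma> algebra_simps)
      moreover have "f x = (- \<sigma>) *\<^sub>R x" if "y = 0"
        using that by (simp add: y_def eq_neg_iff_add_eq_0)
      ultimately have "\<sigma> \<in> eigenvalues f \<or> - \<sigma> \<in> eigenvalues f"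
        using x(1) by (auto simp: eigenvalues_def)
      then show ?thesis using ev[of \<sigma>] ev[of "- \<sigma>"] \<sigma>0 by auto
    qed
    ultimately show ?thesis by simp
  qed
  have smin: "m \<le> sigma_min f" and smax: "sigma_max f \<le> M" and "m \<le> sigma_max f"
    using bounds Min_in[OF fin ne] Max_in[OF fin ne] by (auto simp: sigma_min_def sigma_max_def)
  then have "sigma_max f / sigma_min f \<le> M / m"
    using m by (intro frac_le) auto
  then show ?thesis using smin m by (simp add: cond_def)
qed

lemma norm_adjoint_le:
  fixes f :: "'a::euclidean_space \<Rightarrow> 'b::euclidean_space"
  assumes lin: "linear f" and f: "\<And>x. norm (f x) \<le> c * norm x"
  shows "norm (adjoint f y) \<le> c * norm y"
proof (cases "adjoint f y = 0")
  case True
  \<comment> \<open>Testing the bound on a unit vector supplies the sign of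
    \<open>c\<close>.\<close>
  obtain b :: 'a where "b \<in> Basis" using nonempty_Basis by blast
  then have "norm b = 1" by simp
  then have "norm (f b) \<le> c" using f[of b] by simp
  then have "0 \<le> c" using norm_ge_zero order_trans by blast
  then show ?thesis using True by simp
next
  case False
  have "norm (adjoint f y) * norm (adjoint f y) = y \<bullet> f (adjoint f y)"
    by (simp add: inner_adjoint_left[OF lin, symmetric] power2_norm_eq_inner[symmetric] power2_eq_square)
  also have "\<dots> \<le> norm y * norm (f (adjoint f y))" by (rule norm_cauchy_schwarz)
  also have "\<dots> \<le> norm y * (c * norm (adjoint f y))" by (intro mult_left_mono f) auto
  finally have "norm (adjoint f y) * norm (adjoint f y) \<le> (c * norm y) * norm (adjoint f y)"
    by (simp add: mult_ac)
  then show ?thesis using False by simp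
qed

subsection \<open>The preconditioned KKT operator in block form\<close>

text \<open>Stated for a general \<open>G\<close> so that it serves both diagonal blocks: \<alpha>
  \<open>adjoint R \<circ> R\<close> with \<open>T\<close>, and \<open>adjoint B \<circ> B\<close>
  with \<open>A\<close>. The last three properties are the entries needed to compute
  \<open>E\<close>.\<close>

lemma damped_projector_factorization:
  fixes T :: "'q::euclidean_space \<Rightarrow> 'v::euclidean_space"
  assumes T: "linear T" and G: "\<And>q. 0 \<le> G q \<bullet> q" and \<rho>: "0 < \<rho>"
    and pd: "positive_definite (\<lambda>q. G q + \<rho> *\<^sub>R adjoint T (T q))"
  obtains s X where "positive_definite s" "\<And>q. s (s q) = G q + \<rho> *\<^sub>R adjoint T (T q)"
    "linear X" "\<And>q. norm (X q) \<le> norm q"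
    "X \<circ> adjoint X = T \<circ> inv (\<lambda>q. (1 / \<rho>) *\<^sub>R G q + adjoint T (T q)) \<circ> adjoint T"
    "\<And>q. sqrt \<rho> *\<^sub>R T (inv s q) = X q" "\<And>v. sqrt \<rho> *\<^sub>R inv s (adjoint T v) = adjoint X v"
    "\<And>q. inv s (G (inv s q)) = q - adjoint X (X q)"
proof -
  obtain s where s: "positive_definite s" "s \<circ> s = (\<lambda>q. G q + \<rho> *\<^sub>R adjoint T (T q))"
    using positive_definite_sqrt_exists[OF pd] by blast
  have ss: "s (s q) = G q + \<rho> *\<^sub>R adjoint T (T q)" for q
    using fun_cong[OF s(2), of q] by simp
  have sas: "self_adjoint s" using s(1) by (simp add: positive_definite_def)
  have ls: "linear s" using sas by (rule self_adjoint_linear)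
  have bs: "bij s" using s(1) by (rule positive_definite_bij)
  define i where "i = inv s"
  have si: "s (i q) = q" and i_s: "i (s q) = q" for q
    using bs by (auto simp: i_def bij_is_surj surj_f_inv_f bij_is_inj inv_f_f)
  have sai: "self_adjoint i" unfolding i_def using sas bs by (rule self_adjoint_inv)
  have li: "linear i" using sai by (rule self_adjoint_linear)
  note lT' = adjoint_linear[OF T]
  define X where "X q = sqrt \<rho> *\<^sub>R T (i q)" for q
  have lX: "linear X"
    unfolding X_def by (intro linear_compose_scale_right linear_compose[OF li T, unfolded o_def])
  have aX: "adjoint X = (\<lambda>v. sqrt \<rho> *\<^sub>R i (adjoint T v))"
  proof (rule adjoint_unique, intro allI)
    show "X q \<bullet> v = q \<bullet> sqrt \<rho> *\<^sub>R i (adjoint T v)" for q v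
      by (simp add: X_def self_adjointD[OF sai, symmetric] adjoint_works[OF T])
  qed
  have G_eq: "G q = s (s q) - \<rho> *\<^sub>R adjoint T (T q)" for q
    by (simp add: ss)
  have iGi: "i (G (i q)) = q - adjoint X (X q)" for q
    using \<rho> by (simp add: G_eq si i_s aX X_def linear_diff[OF li] linear_scale[OF li] linear_scale[OF lT'])
  \<comment> \<open>The damping term accounts for the gap: its quadratic form at \<open>i q\<close>
    is exactly \<open>q \<bullet> q - X q \<bullet> X q\<close>.\<close>
  have nX: "norm (X q) \<le> norm q" for q
  proof -
    have "0 \<le> G (i q) \<bullet> i q" by (rule G)
    also have "\<dots> = i (G (i q)) \<bullet> q" by (simp add: self_adjointD[OF sai])
    also have "\<dots> = q \<bullet> q - X q \<bullet> X q"
      by (simp add: iGi inner_diff_left inner_adjoint_left[OF lX])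
    finally show ?thesis by (simp add: norm_le)
  qed
  have "inv (\<lambda>q. (1 / \<rho>) *\<^sub>R G q + adjoint T (T q)) = (\<lambda>q. \<rho> *\<^sub>R i (i q))"
  proof (rule inv_unique_comp)
    \<comment> \<open>The operator inverted in the damped projector is the diagonal block of
      \<open>P\<close> divided by \<rho>.\<close>
    have *: "(1 / \<rho>) *\<^sub>R G q + adjoint T (T q) = (1 / \<rho>) *\<^sub>R s (s q)" for q
      using \<rho> by (simp add: ss algebra_simps)
    show "(\<lambda>q. (1 / \<rho>) *\<^sub>R G q + adjoint T (T q)) \<circ> (\<lambda>q. \<rho> *\<^sub>R i (i q)) = id"
      using \<rho> by (auto simp: * linear_scale[OF ls] si)
    show "(\<lambda>q. \<rho> *\<^sub>R i (i q)) \<circ> (\<lambda>q. (1 / \<rho>) *\<^sub>R G q + adjoint T (T q)) = id"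
      using \<rho> by (auto simp: * linear_scale[OF li] i_s)
  qed
  then have XX: "X \<circ> adjoint X = T \<circ> inv (\<lambda>q. (1 / \<rho>) *\<^sub>R G q + adjoint T (T q)) \<circ> adjoint T"
    using \<rho> by (auto simp: aX X_def linear_scale[OF T] linear_scale[OF li])
  show ?thesis
    by (rule that[OF s(1) ss lX nX XX]) (simp_all only: X_def aX i_def[symmetric] iGi[unfolded X_def aX])
qed

section \<open>Norm and eigenvalue bounds for the block operator\<close>

definition kkt_block :: "('q::euclidean_space \<Rightarrow> 'v::euclidean_space) \<Rightarrow> ('u::euclidean_space \<Rightarrow> 'v) \<Rightarrow>
    'q \<times> 'u \<times> 'v \<Rightarrow> 'q \<times> 'u \<times> 'v" where
  "kkt_block X Y = (\<lambda>(q, u, v).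
     (q - adjoint X (X q) + adjoint X v, u - adjoint Y (Y u) + adjoint Y v, X q + Y u))"

lemma self_adjoint_kkt_block:
  assumes X: "linear X" and Y: "linear Y"
  shows "self_adjoint (kkt_block X Y)"
proof (rule self_adjointI)
  note l = linear_add[OF X] linear_add[OF Y] linear_add[OF adjoint_linear[OF X]]
    linear_add[OF adjoint_linear[OF Y]] linear_scale[OF X] linear_scale[OF Y]
    linear_scale[OF adjoint_linear[OF X]] linear_scale[OF adjoint_linear[OF Y]]
  show "linear (kkt_block X Y)"
    by (rule linearI) (auto simp: kkt_block_def l algebra_simps split: prod.splits)
  show "kkt_block X Y x \<bullet> y = x \<bullet> kkt_block X Y y" for x y
    by (auto simp: kkt_block_def inner_add_left inner_add_right inner_diff_left inner_diff_right
        inner_adjoint_left[OF X] inner_adjoint_left[OF Y] adjoint_works[OF X] adjoint_works[OF Y]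
        split: prod.splits)
qed

text \<open>The row is \<open>p + adjoint F (v - F p)\<close>. After expanding the square and using
  that \<open>adjoint F\<close> is a contraction too, the mixed terms \<open>F p \<bullet> v\<close>
  cancel.\<close>

lemma norm_kkt_block_row_le:
  fixes F :: "'a::euclidean_space \<Rightarrow> 'b::euclidean_space"
  assumes F: "linear F" and nF: "\<And>p. norm (F p) \<le> norm p"
  shows "(norm (p - adjoint F (F p) + adjoint F v))\<^sup>2 \<le> p \<bullet> p + v \<bullet> v - F p \<bullet> F p"
proof -
  let ?w = "v - F p"
  have "p - adjoint F (F p) + adjoint F v = p + adjoint F ?w"
    by (simp add: linear_diff[OF adjoint_linear[OF F]])
  then have "(norm (p - adjoint F (F p) + adjoint F v))\<^sup>2 = (norm (p + adjoint F ?w))\<^sup>2"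
    by (rule arg_cong)
  also have "\<dots> = p \<bullet> p + 2 * (p \<bullet> adjoint F ?w) + (norm (adjoint F ?w))\<^sup>2"
    by (simp add: power2_norm_eq_inner inner_add_left inner_add_right inner_commute)
  also have "p \<bullet> adjoint F ?w = F p \<bullet> ?w" by (rule adjoint_works[OF F])
  also have "(norm (adjoint F ?w))\<^sup>2 \<le> (norm ?w)\<^sup>2"
    using norm_adjoint_le[OF F, of 1] nF by (intro power_mono) auto
  also have "(norm ?w)\<^sup>2 = ?w \<bullet> ?w" by (simp add: power2_norm_eq_inner)
  finally show ?thesis
    by (simp add: inner_diff_left inner_diff_right inner_commute)
qed

text \<open>The negative terms of the two row bounds cancel the squares in the norm of
  \<open>X q + Y u\<close>; only \<open>2 * (X q \<bullet> Y u)\<close> is left to estimate.\<close>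

lemma norm_kkt_block_le:
  assumes X: "linear X" and Y: "linear Y"
    and nX: "\<And>q. norm (X q) \<le> norm q" and nY: "\<And>u. norm (Y u) \<le> norm u"
  shows "norm (kkt_block X Y z) \<le> sqrt 2 * norm z"
proof -
  obtain q u v where z: "z = (q, u, v)" by (cases z) auto
  have "2 * (X q \<bullet> Y u) \<le> 2 * (norm (X q) * norm (Y u))"
    using norm_cauchy_schwarz[of "X q" "Y u"] by simp
  also have "\<dots> \<le> 2 * (norm q * norm u)" by (intro mult_left_mono mult_mono nX nY) auto
  also have "\<dots> \<le> (norm q)\<^sup>2 + (norm u)\<^sup>2" using sum_squares_bound[of "norm q" "norm u"] by simp
  finally have cross: "2 * (X q \<bullet> Y u) \<le> q \<bullet> q + u \<bullet> u" by (simp add: power2_norm_eq_inner)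
  have "(norm (kkt_block X Y z))\<^sup>2 = (norm (q - adjoint X (X q) + adjoint X v))\<^sup>2 +
      (norm (u - adjoint Y (Y u) + adjoint Y v))\<^sup>2 + (X q + Y u) \<bullet> (X q + Y u)"
    by (simp add: z kkt_block_def power2_norm_eq_inner)
  also have "\<dots> \<le> q \<bullet> q + u \<bullet> u + 2 * (v \<bullet> v) + 2 * (X q \<bullet> Y u)"
    using norm_kkt_block_row_le[OF X nX, of q v] norm_kkt_block_row_le[OF Y nY, of u v]
    by (simp add: inner_add_left inner_add_right inner_commute)
  also have "\<dots> \<le> 2 * (q \<bullet> q + u \<bullet> u + v \<bullet> v)" using cross by simp
  also have "\<dots> = (sqrt 2 * norm z)\<^sup>2" by (simp add: z power_mult_distrib power2_norm_eq_inner)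
  finally show ?thesis by (rule power2_le_imp_le) simp
qed

text \<open>An energy identity links \<open>N\<close>, the size of \<open>(q, u)\<close>, to
  \<open>V\<close>, the size of \<open>v\<close>. For positive \<open>l\<close> its signs alone
  exclude \<open>l < 1 - \<beta>\<close>. Otherwise it gives
  \<open>(1 - \<beta>) * N \<le> - l * V\<close>, while \<open>infsup\<close> gives
  \<open>\<delta> * V \<le> 2 * N\<close>.\<close>

lemma eigenvalue_kkt_block_ge:
  fixes X :: "'q::euclidean_space \<Rightarrow> 'v::euclidean_space" and Y :: "'u::euclidean_space \<Rightarrow> 'v"
  assumes X: "linear X" and Y: "linear Y"
    and angle: "\<And>q u. \<bar>X q \<bullet> Y u\<bar> \<le> \<beta> * (norm q * norm u)"
    and infsup: "\<And>v. 2 * \<delta> * (v \<bullet> v) \<le> adjoint X v \<bullet> adjoint X v + adjoint Y v \<bullet> adjoint Y v"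
    and \<beta>: "0 \<le> \<beta>" "\<beta> < 1" and \<delta>: "0 < \<delta>" "\<delta> \<le> 1"
    and l: "l \<in> eigenvalues (kkt_block X Y)"
  shows "(1 - \<beta>) * \<delta> / 2 \<le> \<bar>l\<bar>"
proof -
  obtain q u v where ne: "(q, u, v) \<noteq> 0" and "kkt_block X Y (q, u, v) = l *\<^sub>R (q, u, v)"
    using l by (auto simp: eigenvalues_def)
  then have e1: "q - adjoint X (X q) + adjoint X v = l *\<^sub>R q"
    and e2: "u - adjoint Y (Y u) + adjoint Y v = l *\<^sub>R u" and e3: "X q + Y u = l *\<^sub>R v"
    by (auto simp: kkt_block_def)
  define N where "N = q \<bullet> q + u \<bullet> u"
  define V where "V = v \<bullet> v"
  have N0: "N \<ge> 0" and V0: "V \<ge> 0" by (auto simp: N_def V_def)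
  have NV: "\<not> (N = 0 \<and> V = 0)"
    using ne by (auto simp: N_def V_def zero_prod_def add_nonneg_eq_0_iff)
  define p where "p = 2 * (X q \<bullet> Y u)"
  have qu: "2 * (norm q * norm u) \<le> N"
    using sum_squares_bound[of "norm q" "norm u"] by (simp add: N_def power2_norm_eq_inner)
  have "\<bar>p\<bar> \<le> \<beta> * (2 * (norm q * norm u))" using angle[of q u] by (simp add: p_def)
  also have "\<dots> \<le> \<beta> * N" using qu \<beta>(1) by (rule mult_left_mono)
  finally have p: "- (\<beta> * N) \<le> p" by simp
  \<comment> \<open>Add the first two eigenvalue equations paired with \<open>q\<close> and \<open>u\<close>, and eliminate \<open>Xq + Yu\<close> with the third.\<close>
  have energy: "N + p - l * N + l * (1 - l) * V = 0"
  proof -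
    have i1: "q \<bullet> q - X q \<bullet> X q + v \<bullet> X q = l * (q \<bullet> q)"
      using arg_cong[OF e1, of "\<lambda>w. w \<bullet> q"]
      by (simp add: inner_add_left inner_diff_left inner_adjoint_left[OF X])
    have i2: "u \<bullet> u - Y u \<bullet> Y u + v \<bullet> Y u = l * (u \<bullet> u)"
      using arg_cong[OF e2, of "\<lambda>w. w \<bullet> u"]
      by (simp add: inner_add_left inner_diff_left inner_adjoint_left[OF Y])
    have i3: "v \<bullet> X q + v \<bullet> Y u = l * V"
      using arg_cong[OF e3, of "\<lambda>w. v \<bullet> w"] by (simp add: inner_add_right V_def)
    have i4: "X q \<bullet> X q + Y u \<bullet> Y u + p = l * (l * V)"
      using arg_cong[OF e3, of "\<lambda>w. w \<bullet> w"]
      by (simp add: inner_add_left inner_add_right inner_commute p_def V_def)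
    have "N + p = l * N - l * V + l * (l * V)" 
      using i1 i2 i3 i4 unfolding N_def distrib_left by linarith
    then show ?thesis by (simp add: algebra_simps)
  qed
  have \<kappa>: "0 < 1 - \<beta>" using \<beta> by simp
  show ?thesis
  proof (cases "l > 0")
    case True
    have "1 - \<beta> \<le> l"
    proof (rule ccontr)
      assume "\<not> ?thesis"
      \<comment> \<open>Both terms of the energy bound below are then nonnegative with sum at most
        0, so \<open>N\<close> and \<open>V\<close> vanish, against \<open>ne\<close>.\<close>
      then have h: "1 - \<beta> - l > 0" "1 - l > 0" using \<beta> by auto
      have "(1 - \<beta> - l) * N + l * (1 - l) * V \<le> 0"
        using energy p by (simp add: algebra_simps)
      moreover have "0 \<le> (1 - \<beta> - l) * N" "0 \<le> l * (1 - l) * V"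
        using h True N0 V0 by auto
      ultimately have "(1 - \<beta> - l) * N = 0" "l * (1 - l) * V = 0" by linarith+
      then show False using NV h True by auto
    qed
    moreover have "(1 - \<beta>) * \<delta> / 2 \<le> 1 - \<beta>"
      using \<kappa> \<delta> mult_left_mono[of \<delta> 2 "1 - \<beta>"] by simp
    ultimately show ?thesis by linarith
  next
    case False
    define \<mu> where "\<mu> = - l"
    define c where "c = 1 + \<mu>"
    have \<mu>: "\<mu> \<ge> 0" and c: "c \<ge> 1" and cl: "c = 1 - l" using False by (auto simp: \<mu>_def c_def)
    have energy': "(c - \<beta>) * N \<le> \<mu> * c * V"
      using energy p by (simp add: \<mu>_def cl algebra_simps)
    \<comment> \<open>Multiplying the adjoint terms by \<open>1 - l\<close> cancels \<open>X\<^sup>*X\<close> and \<open>Y\<^sup>*Y\<close>; only cross terms, bounded by \<open>\<beta>\<close>, remain.\<close>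
    have r1: "c *\<^sub>R adjoint X v = - (c *\<^sub>R q + adjoint X (Y u))"
    proof -
      have "l *\<^sub>R adjoint X v = adjoint X (X q) + adjoint X (Y u)"
        using e3 by (simp add: linear_scale[OF adjoint_linear[OF X], symmetric]
            linear_add[OF adjoint_linear[OF X], symmetric])
      with e1 show ?thesis by (simp add: cl algebra_simps)
    qed
    have r2: "c *\<^sub>R adjoint Y v = - (c *\<^sub>R u + adjoint Y (X q))"
    proof -
      have "l *\<^sub>R adjoint Y v = adjoint Y (X q) + adjoint Y (Y u)"
        using e3 by (simp add: linear_scale[OF adjoint_linear[OF Y], symmetric]
            linear_add[OF adjoint_linear[OF Y], symmetric])
      with e2 show ?thesis by (simp add: cl algebra_simps)
    qed
    \<comment> \<open>Apply \<open>angle\<close> with the vector \<open>adjoint X (Y u)\<close>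
      itself in the place of \<open>q\<close>.\<close>
    have n1: "norm (adjoint X (Y u)) \<le> \<beta> * norm u"
    proof -
      let ?w = "adjoint X (Y u)"
      have "norm ?w * norm ?w = X ?w \<bullet> Y u"
        by (simp add: adjoint_works[OF X, symmetric] norm_eq_sqrt_inner)
      also have "\<dots> \<le> (\<beta> * norm u) * norm ?w" using angle[of ?w u] by (simp add: mult_ac)
      finally show ?thesis using \<beta>(1) by (cases "?w = 0") auto
    qed
    have n2: "norm (adjoint Y (X q)) \<le> \<beta> * norm q"
    proof -
      let ?w = "adjoint Y (X q)"
      have "norm ?w * norm ?w = X q \<bullet> Y ?w"
        by (simp add: inner_adjoint_left[OF Y, symmetric] norm_eq_sqrt_inner)
      also have "\<dots> \<le> (\<beta> * norm q) * norm ?w" using angle[of q ?w] by (simp add: mult_ac)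
      finally show ?thesis using \<beta>(1) by (cases "?w = 0") auto
    qed
    have "norm (c *\<^sub>R adjoint X v) \<le> c * norm q + \<beta> * norm u"
      unfolding r1 norm_minus_cancel
      using norm_triangle_ineq[of "c *\<^sub>R q" "adjoint X (Y u)"] n1 c by simp
    then have b1: "(norm (c *\<^sub>R adjoint X v))\<^sup>2 \<le> (c * norm q + \<beta> * norm u)\<^sup>2"
      by (rule power_mono) simp
    have "norm (c *\<^sub>R adjoint Y v) \<le> c * norm u + \<beta> * norm q"
      unfolding r2 norm_minus_cancel
      using norm_triangle_ineq[of "c *\<^sub>R u" "adjoint Y (X q)"] n2 c by simp
    then have b2: "(norm (c *\<^sub>R adjoint Y v))\<^sup>2 \<le> (c * norm u + \<beta> * norm q)\<^sup>2"
      by (rule power_mono) simp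
    \<comment> \<open>\<open>infsup\<close> times \<open>c\<^sup>2\<close>, so that
      \<open>b1\<close> and \<open>b2\<close> apply; the factor 4 at the end comes from
      \<open>\<beta> < 1 \<le> c\<close>.\<close>
    have "c\<^sup>2 * (2 * \<delta> * V) \<le> c\<^sup>2 * (adjoint X v \<bullet> adjoint X v + adjoint Y v \<bullet> adjoint Y v)"
      using infsup[of v] by (intro mult_left_mono) (auto simp: V_def)
    also have "\<dots> = (norm (c *\<^sub>R adjoint X v))\<^sup>2 + (norm (c *\<^sub>R adjoint Y v))\<^sup>2"
      by (simp add: power_mult_distrib power2_norm_eq_inner distrib_left)
    also have "\<dots> \<le> (c * norm q + \<beta> * norm u)\<^sup>2 + (c * norm u + \<beta> * norm q)\<^sup>2"
      using b1 b2 by simp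
    also have "\<dots> = (c\<^sup>2 + \<beta>\<^sup>2) * N + (2 * c * \<beta>) * (2 * (norm q * norm u))"
      by (simp add: N_def power2_norm_eq_inner[symmetric] power2_eq_square algebra_simps)
    also have "\<dots> \<le> (c\<^sup>2 + \<beta>\<^sup>2) * N + (2 * c * \<beta>) * N"
      using qu c \<beta>(1) by (intro add_left_mono mult_left_mono) auto
    also have "\<dots> = (c + \<beta>)\<^sup>2 * N" by (simp add: power2_eq_square algebra_simps)
    also have "\<dots> \<le> (2 * c)\<^sup>2 * N"
      using N0 \<beta> c by (intro mult_right_mono power_mono) auto
    finally have "c\<^sup>2 * (2 * \<delta> * V) \<le> c\<^sup>2 * (4 * N)" by (simp add: power_mult_distrib)
    then have main: "\<delta> * V \<le> 2 * N" using c by (simp add: mult.commute)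
    \<comment> \<open>This makes \<open>c\<close> a common factor of both sides of
      \<open>energy'\<close>, so that it can be cancelled.\<close>
    have "(1 - \<beta>) * c \<le> c - \<beta>" using \<beta>(1) c mult_left_mono[of 1 c \<beta>] by (simp add: algebra_simps)
    then have "((1 - \<beta>) * c) * N \<le> (c - \<beta>) * N" using N0 by (rule mult_right_mono)
    with energy' have "c * ((1 - \<beta>) * N) \<le> c * (\<mu> * V)" by (simp add: mult_ac)
    then have en: "(1 - \<beta>) * N \<le> \<mu> * V" using c by simp
    have "V > 0"
    proof (rule ccontr)
      assume "\<not> V > 0"
      then have "V = 0" using V0 by simp
      with en have "N \<le> 0" using \<kappa> by (simp add: mult_le_0_iff)
      then show False using NV N0 \<open>V = 0\<close> by simp
    qed
    have "(1 - \<beta>) * (\<delta> * V) \<le> (1 - \<beta>) * (2 * N)" using main \<kappa> by (intro mult_left_mono) auto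
    also have "\<dots> \<le> (2 * \<mu>) * V" using en by simp
    finally have "((1 - \<beta>) * \<delta>) * V \<le> (2 * \<mu>) * V" by (simp add: mult.assoc)
    then have "(1 - \<beta>) * \<delta> \<le> 2 * \<mu>" using \<open>V > 0\<close> by simp
    then show ?thesis using \<mu> by (simp add: \<mu>_def)
  qed
qed

text \<open>The bound on \<open>lambda_min\<close> becomes the inf-sup condition through the
  Rayleigh quotient; the bound on \<open>lambda_max\<close> becomes the angle condition through the
  norm of \<open>adjoint Y \<circ> X\<close>.\<close>

lemma cond_kkt_block_le:
  fixes X :: "'q::euclidean_space \<Rightarrow> 'v::euclidean_space" and Y :: "'u::euclidean_space \<Rightarrow> 'v"
  assumes X: "linear X" and Y: "linear Y"
    and nX: "\<And>q. norm (X q) \<le> norm q" and nY: "\<And>u. norm (Y u) \<le> norm u"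
    and \<delta>: "0 < \<delta>" "2 * \<delta> \<le> lambda_min (\<lambda>v. X (adjoint X v) + Y (adjoint Y v))"
    and \<beta>: "sqrt (lambda_max ((X \<circ> adjoint X) \<circ> (Y \<circ> adjoint Y))) \<le> \<beta>" "\<beta> < 1"
  shows "cond (kkt_block X Y) \<le> ereal (3 / ((1 - \<beta>) * \<delta>))"
proof -
  note lX' = adjoint_linear[OF X] and lY' = adjoint_linear[OF Y]
  have infsup: "2 * \<delta> * (v \<bullet> v) \<le> adjoint X v \<bullet> adjoint X v + adjoint Y v \<bullet> adjoint Y v" for v
  proof -
    let ?S = "\<lambda>v. X (adjoint X v) + Y (adjoint Y v)"
    have "linear ?S"
      using linear_compose_add[OF linear_compose[OF lX' X] linear_compose[OF lY' Y]] by (simp add: o_def)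
    then have S: "self_adjoint ?S"
      by (rule self_adjointI) (simp add: inner_add_left inner_add_right adjoint_works[OF X]
          adjoint_works[OF Y] inner_adjoint_left[OF X, symmetric] inner_adjoint_left[OF Y, symmetric])
    obtain l where l: "l \<in> eigenvalues ?S" "\<And>y. l * (y \<bullet> y) \<le> ?S y \<bullet> y"
      using min_eigenvalue[OF S] by metis
    have "2 * \<delta> \<le> l"
      using \<delta>(2) Min_le[OF finite_eigenvalues[OF S] l(1)] by (simp add: lambda_min_def)
    then have "2 * \<delta> * (v \<bullet> v) \<le> l * (v \<bullet> v)" by (rule mult_right_mono) simp
    also have "\<dots> \<le> ?S v \<bullet> v" by (rule l(2))
    finally show ?thesis by (simp add: inner_add_left adjoint_works[OF X] adjoint_works[OF Y])
  qed
  \<comment> \<open>For a unit vector the right side of \<open>infsup\<close> is at most 2, since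
    both adjoints are contractions.\<close>
  have "\<delta> \<le> 1"
  proof -
    obtain v :: 'v where v: "v \<in> Basis" using nonempty_Basis by blast
    then have nv: "norm v = 1" by simp
    have "(norm (adjoint X v))\<^sup>2 \<le> 1\<^sup>2" "(norm (adjoint Y v))\<^sup>2 \<le> 1\<^sup>2"
      using norm_adjoint_le[OF X, of 1 v] norm_adjoint_le[OF Y, of 1 v] nX nY nv
      by (intro power_mono; simp)+
    then show ?thesis using infsup[of v] nv by (simp add: power2_norm_eq_inner[symmetric])
  qed
  let ?Z = "adjoint Y \<circ> X"
  have lZ: "linear ?Z" using X lY' by (rule linear_compose)
  have aZ: "adjoint ?Z = adjoint X \<circ> Y"
    by (rule adjoint_unique) (simp add: inner_adjoint_left[OF Y] adjoint_works[OF X])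
  let ?Q = "(X \<circ> adjoint X) \<circ> (Y \<circ> adjoint Y)"
  let ?F = "adjoint ?Z \<circ> ?Z"
  have F: "self_adjoint ?F"
    using linear_compose[OF lZ adjoint_linear[OF lZ]]
    by (rule self_adjointI) (simp add: inner_adjoint_left[OF lZ, unfolded o_def] adjoint_works[OF lZ, unfolded o_def, symmetric] o_def)
  have lW: "linear (adjoint X \<circ> Y \<circ> adjoint Y)"
    using lX' Y lY' by (intro linear_compose)
  have Q: "?Q = X \<circ> (adjoint X \<circ> Y \<circ> adjoint Y)" and F': "?F = (adjoint X \<circ> Y \<circ> adjoint Y) \<circ> X"
    by (auto simp: aZ)
  \<comment> \<open>\<open>?Q\<close> need not be self-adjoint, but moving the factor
    \<open>X\<close> to the other end gives \<open>?F\<close>, which is.\<close>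
  have finQ: "finite (eigenvalues ?Q)"
    using eigenvalues_comp_subset[OF X lW] finite_eigenvalues[OF F] unfolding Q F'
    by (meson finite_insert finite_subset)
  obtain k where k: "k \<in> eigenvalues ?F" and top: "\<And>q. ?F q \<bullet> q \<le> k * (q \<bullet> q)"
    using max_eigenvalue[OF F] by metis
  have Zk: "(norm (?Z q))\<^sup>2 \<le> k * (norm q)\<^sup>2" for q
    using top[of q] inner_adjoint_left[OF lZ, of "?Z q" q] by (simp add: power2_norm_eq_inner)
  have k0: "0 \<le> k"
  proof -
    obtain b :: 'q where "b \<in> Basis" using nonempty_Basis by blast
    then show ?thesis using Zk[of b] by (simp add: order_trans[OF zero_le_power2])
  qed
  have "k \<in> eigenvalues ?Q"
  \<comment> \<open>Exchanging factors transfers only nonzero eigenvalues. If \<open>k = 0\<close>,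
    then \<open>?Z\<close> and hence \<open>?Q\<close> vanish, and 0 is an eigenvalue because the
    space is nonzero.\<close>
  proof (cases "k = 0")
    case True
    have "?Z q = 0" for q using Zk[of q] True by simp
    then have "adjoint ?Z = (\<lambda>_. 0)"
      by (intro adjoint_unique) simp
    then have "adjoint X (Y w) = 0" for w by (metis aZ comp_apply)
    then have "?Q v = 0" for v by (simp add: linear_0[OF X])
    moreover obtain b :: 'v where "b \<noteq> 0" using nonempty_Basis nonzero_Basis by blast
    ultimately show ?thesis using True by (auto simp: eigenvalues_def)
  next
    case False
    then show ?thesis using k eigenvalues_comp_subset[OF lW X] unfolding Q F' by blast
  qed
  then have "k \<le> lambda_max ?Q" unfolding lambda_max_def by (rule Max_ge[OF finQ])
  then have k\<beta>: "sqrt k \<le> \<beta>" using \<beta>(1) real_sqrt_le_mono by (meson order_trans)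
  then have \<beta>0: "0 \<le> \<beta>" using k0 by (meson order_trans real_sqrt_ge_zero)
  have angle: "\<bar>X q \<bullet> Y u\<bar> \<le> \<beta> * (norm q * norm u)" for q u
  proof -
    have "(norm (?Z q))\<^sup>2 \<le> (sqrt k * norm q)\<^sup>2" using Zk[of q] k0 by (simp add: power_mult_distrib)
    then have "norm (?Z q) \<le> sqrt k * norm q" by (rule power2_le_imp_le) (simp add: k0)
    also have "\<dots> \<le> \<beta> * norm q" using k\<beta> by (rule mult_right_mono) simp
    finally have Zq: "norm (?Z q) \<le> \<beta> * norm q" .
    have "\<bar>X q \<bullet> Y u\<bar> = \<bar>?Z q \<bullet> u\<bar>" by (simp add: inner_adjoint_left[OF Y])
    also have "\<dots> \<le> norm (?Z q) * norm u" by (rule Cauchy_Schwarz_ineq2)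
    also have "\<dots> \<le> (\<beta> * norm q) * norm u" using Zq by (rule mult_right_mono) simp
    finally show ?thesis by (simp add: mult.assoc)
  qed
  define m where "m = (1 - \<beta>) * \<delta> / 2"
  have m: "0 < m" using \<delta>(1) \<beta>(2) by (simp add: m_def)
  have "cond (kkt_block X Y) \<le> ereal (sqrt 2 / m)"
    using eigenvalue_kkt_block_ge[OF X Y angle infsup \<beta>0 \<beta>(2) \<delta>(1) \<open>\<delta> \<le> 1\<close>]
    by (intro cond_self_adjoint_le[OF self_adjoint_kkt_block[OF X Y] norm_kkt_block_le[OF X Y nX nY] m])
      (simp add: m_def)
  \<comment> \<open>The constant 3 arises here: \<open>3 / 2\<close> bounds the square root of 2,
    and \<open>m\<close> contributes the other factor 2.\<close>
  also have "sqrt 2 / m \<le> (3 / 2) / m"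
    using m by (intro divide_right_mono real_le_lsqrt) (auto simp: power2_eq_square)
  also have "(3 / 2) / m = 3 / ((1 - \<beta>) * \<delta>)" by (simp add: m_def)
  finally show ?thesis by simp
qed

section \<open>Positive definiteness and the passage to \<open>E\<close>\<close>

text \<open>Strictness may come from either summand: injectivity of \<open>R\<close> supplies it in
  the first block of \<open>P\<close>, injectivity of \<open>A\<close> in the second.\<close>

lemma positive_definite_gram:
  fixes S :: "'a::euclidean_space \<Rightarrow> 'b::euclidean_space" and T :: "'a \<Rightarrow> 'c::euclidean_space"
  assumes S: "linear S" and T: "linear T" and a: "0 \<le> a" and b: "0 \<le> b"
    and pos: "\<And>x. x \<noteq> 0 \<Longrightarrow> 0 < a * (S x \<bullet> S x) \<or> 0 < b * (T x \<bullet> T x)"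
  shows "positive_definite (\<lambda>x. a *\<^sub>R adjoint S (S x) + b *\<^sub>R adjoint T (T x))"
proof -
  let ?f = "\<lambda>x. a *\<^sub>R adjoint S (S x) + b *\<^sub>R adjoint T (T x)"
  have f: "?f x \<bullet> y = a * (S x \<bullet> S y) + b * (T x \<bullet> T y)" for x y
    by (simp add: inner_add_left inner_adjoint_left[OF S] inner_adjoint_left[OF T])
  have "linear ?f"
    using linear_compose[OF S adjoint_linear[OF S]] linear_compose[OF T adjoint_linear[OF T]]
    by (intro linear_compose_add linear_compose_scale_right) (simp_all add: o_def)
  moreover have "?f x \<bullet> y = x \<bullet> ?f y" for x y
    using f[of x y] f[of y x] by (simp add: inner_commute)
  ultimately have "self_adjoint ?f" by (rule self_adjointI)
  moreover have "0 < ?f x \<bullet> x" if "x \<noteq> 0" for x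
    using pos[OF that] mult_nonneg_nonneg[OF a inner_ge_zero[of "S x"]]
      mult_nonneg_nonneg[OF b inner_ge_zero[of "T x"]] unfolding f by linarith
  ultimately show ?thesis by (simp add: positive_definite_def)
qed

lemma positive_definite_block_diag:
  assumes s: "positive_definite s" and t: "positive_definite t" and c: "0 < c"
  shows "positive_definite (\<lambda>(q, u, v). (s q, t u, c *\<^sub>R v))"
proof -
  have ss: "self_adjoint s" and st: "self_adjoint t"
    using s t by (auto simp: positive_definite_def)
  have ls: "linear s" and lt: "linear t"
    using ss st by (auto intro: self_adjoint_linear)
  have nonneg: "0 \<le> s q \<bullet> q" "0 \<le> t u \<bullet> u" for q u
    using s t linear_0[OF ls] linear_0[OF lt] unfolding positive_definite_def
    by (metis inner_zero_left less_imp_le order_refl)+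
  have "self_adjoint (\<lambda>(q, u, v). (s q, t u, c *\<^sub>R v))"
  proof (rule self_adjointI)
    show "linear (\<lambda>(q, u, v). (s q, t u, c *\<^sub>R v))"
      by (rule linearI) (auto simp: linear_add[OF ls] linear_add[OF lt] linear_scale[OF ls]
          linear_scale[OF lt] algebra_simps)
  qed (auto simp: self_adjointD[OF ss] self_adjointD[OF st])
  moreover have "0 < s q \<bullet> q + (t u \<bullet> u + c * (v \<bullet> v))" if "(q, u, v) \<noteq> 0" for q u v
  proof -
    have "q \<noteq> 0 \<or> u \<noteq> 0 \<or> v \<noteq> 0" using that by (auto simp: zero_prod_def)
    then have "0 < s q \<bullet> q \<or> 0 < t u \<bullet> u \<or> 0 < c * (v \<bullet> v)"
      using s t c by (auto simp: positive_definite_def)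
    moreover have "0 \<le> c * (v \<bullet> v)" using c by simp
    ultimately show ?thesis using nonneg(1)[of q] nonneg(2)[of u] by linarith
  qed
  ultimately show ?thesis by (auto simp: positive_definite_def)
qed

theorem theorem3p7:
  fixes R :: "'q::euclidean_space \<Rightarrow> 'z::euclidean_space"
    and T :: "'q \<Rightarrow> 'v::euclidean_space"
    and B :: "'u::euclidean_space \<Rightarrow> 'y::euclidean_space"
    and A :: "'u \<Rightarrow> 'v"
    and \<alpha> \<rho> \<delta> \<beta> :: real
  assumes "DIM('u) = DIM('v)"
    and "linear R" and "bij R"
    and "linear A" and "bij A"
    and "linear T" and "linear B"
    and "\<alpha> > 0" and "\<rho> > 0"
    and "0 < \<delta>"
    and "\<delta> \<le> 1 / 2 * lambda_min (\<lambda>v. damped_proj_R \<alpha> \<rho> R T v + damped_proj_J \<rho> B A v)"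
    and "sqrt (lambda_max (damped_proj_R \<alpha> \<rho> R T \<circ> damped_proj_J \<rho> B A)) \<le> \<beta>"
    and "\<beta> < 1"
  shows "cond (precond_kkt_op \<alpha> \<rho> R T B A) \<le> ereal (3 / ((1 - \<beta>) * \<delta>))"
proof -
  note R = \<open>linear R\<close> and A = \<open>linear A\<close> and T = \<open>linear T\<close> and B = \<open>linear B\<close>
  have R0: "R q \<noteq> 0" if "q \<noteq> 0" for q
    using that \<open>bij R\<close> by (metis R bij_is_inj linear_injective_0)
  have A0: "A u \<noteq> 0" if "u \<noteq> 0" for u
    using that \<open>bij A\<close> by (metis A bij_is_inj linear_injective_0)
  define G where "G q = \<alpha> *\<^sub>R adjoint R (R q)" for q
  have pd1: "positive_definite (\<lambda>q. G q + \<rho> *\<^sub>R adjoint T (T q))"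
    unfolding G_def using \<open>\<alpha> > 0\<close> \<open>\<rho> > 0\<close> R0 by (intro positive_definite_gram R T) auto
  have pd2: "positive_definite (\<lambda>u. adjoint B (B u) + \<rho> *\<^sub>R adjoint A (A u))"
    using positive_definite_gram[OF B A, of 1 \<rho>] \<open>\<rho> > 0\<close> A0 by simp
  have G1: "0 \<le> G q \<bullet> q" for q
    unfolding G_def using \<open>\<alpha> > 0\<close> by (simp add: inner_adjoint_left[OF R])
  have G2: "0 \<le> adjoint B (B u) \<bullet> u" for u
    by (simp add: inner_adjoint_left[OF B])
  obtain s X where s: "positive_definite s" "\<And>q. s (s q) = G q + \<rho> *\<^sub>R adjoint T (T q)"
    and X: "linear X" "\<And>q. norm (X q) \<le> norm q"
    "X \<circ> adjoint X = T \<circ> inv (\<lambda>q. (1 / \<rho>) *\<^sub>R G q + adjoint T (T q)) \<circ> adjoint T"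
    "\<And>q. sqrt \<rho> *\<^sub>R T (inv s q) = X q" "\<And>v. sqrt \<rho> *\<^sub>R inv s (adjoint T v) = adjoint X v"
    "\<And>q. inv s (G (inv s q)) = q - adjoint X (X q)"
  proof (rule damped_projector_factorization[OF T G1 \<open>\<rho> > 0\<close> pd1], goal_cases)
    case (1 s X)
    from 1(2-) show ?case by (rule that)
  qed
  obtain t Y where t: "positive_definite t" "\<And>u. t (t u) = adjoint B (B u) + \<rho> *\<^sub>R adjoint A (A u)"
    and Y: "linear Y" "\<And>u. norm (Y u) \<le> norm u"
    "Y \<circ> adjoint Y = A \<circ> inv (\<lambda>u. (1 / \<rho>) *\<^sub>R adjoint B (B u) + adjoint A (A u)) \<circ> adjoint A"
    "\<And>u. sqrt \<rho> *\<^sub>R A (inv t u) = Y u" "\<And>v. sqrt \<rho> *\<^sub>R inv t (adjoint A v) = adjoint Y v"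
    "\<And>u. inv t (adjoint B (B (inv t u))) = u - adjoint Y (Y u)"
  proof (rule damped_projector_factorization[OF A G2 \<open>\<rho> > 0\<close> pd2], goal_cases)
    case (1 t Y)
    from 1(2-) show ?case by (rule that)
  qed
  have QR: "damped_proj_R \<alpha> \<rho> R T = X \<circ> adjoint X"
    by (simp add: damped_proj_R_def X(3) G_def)
  have QJ: "damped_proj_J \<rho> B A = Y \<circ> adjoint Y"
    by (simp add: damped_proj_J_def Y(3))
  \<comment> \<open>The blockwise root is positive definite and squares to \<open>P\<close>, so
    uniqueness identifies it with \<open>pd_sqrt\<close>.\<close>
  have sqrtP: "pd_sqrt (precond_op \<alpha> \<rho> R T B A) = (\<lambda>(q, u, v). (s q, t u, (1 / sqrt \<rho>) *\<^sub>R v))"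
    using positive_definite_block_diag[OF s(1) t(1), of "1 / sqrt \<rho>"] \<open>\<rho> > 0\<close>
    by (intro pd_sqrt_eqI) (auto simp: precond_op_def G_def s(2) t(2))
  have bs: "bij s" and bt: "bij t" using s(1) t(1) by (auto intro: positive_definite_bij)
  have invP: "inv (pd_sqrt (precond_op \<alpha> \<rho> R T B A)) = (\<lambda>(q, u, v). (inv s q, inv t u, sqrt \<rho> *\<^sub>R v))"
    unfolding sqrtP using bs bt \<open>\<rho> > 0\<close>
    by (intro inv_unique_comp) (auto simp: bij_is_surj surj_f_inv_f bij_is_inj inv_f_f)
  have li: "linear (inv s)" "linear (inv t)"
    using s(1) t(1) bs bt self_adjoint_inv self_adjoint_linear unfolding positive_definite_def by blast+
  \<comment> \<open>The factor \<open>sqrt \<rho>\<close> from the third block, paired with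
    \<open>inv s\<close> or \<open>inv t\<close>, turns \<open>T\<close> and \<open>A\<close> into
    \<open>X\<close> and \<open>Y\<close>, and their adjoints likewise.\<close>
  have "precond_kkt_op \<alpha> \<rho> R T B A = kkt_block X Y"
    unfolding precond_kkt_op_def invP
    by (auto simp: kkt_op_def kkt_block_def linear_add[OF li(1)] linear_add[OF li(2)]
        linear_scale[OF adjoint_linear[OF T]] linear_scale[OF adjoint_linear[OF A]]
        linear_scale[OF li(1)] linear_scale[OF li(2)] scaleR_add_right X(4,5) Y(4-6)
        X(6)[unfolded G_def linear_scale[OF li(1)]])
  moreover have "cond (kkt_block X Y) \<le> ereal (3 / ((1 - \<beta>) * \<delta>))"
  proof (rule cond_kkt_block_le[OF X(1) Y(1) X(2) Y(2) \<open>0 < \<delta>\<close> _ _ \<open>\<beta> < 1\<close>])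
    show "2 * \<delta> \<le> lambda_min (\<lambda>v. X (adjoint X v) + Y (adjoint Y v))"
      using assms(11) by (simp add: QR QJ)
    show "sqrt (lambda_max ((X \<circ> adjoint X) \<circ> (Y \<circ> adjoint Y))) \<le> \<beta>"
      using assms(12) by (simp add: QR QJ)
  qed
  ultimately show ?thesis by simp
qed

end
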